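(* Let $s$ be an even positive integer, and let $bc_s(n)$ denote the number of $\overline{s}$-core partitions of $n$. Then \[ \sum_{n=0}^{\infty}bc_{s}(n)q^n=\frac{(-q;q)_\infty\,(q^{s};q^{s})^{(s-2)/2}_\infty}{(-q^{s/2};q^{s/2})_\infty}\sum_{n\geq 0} q^{sn^2/2}. \]
   Context: A strict partition $\lambda=(\lambda_1>\lambda_2>\cdots>\lambda_\ell)$ of $n$ is a finite (possibly empty) strictly decreasing sequence of positive integers with sum $n$. The bar lengths in the $i$th row of $\lambda$ are the elements of $\{\lambda_i+\lambda_{i+1},\dots,\lambda_i+\lambda_\ell\}\cup\big(\{1,2,\dots,\lambda_i\}\setminus\{\lambda_i-\lambda_{i+1},\dots,\lambda_i-\lambda_\ell\}\big)$. A strict partition $\lambda$ is an $\overline{s}$-core if $s$ is not a bar length in any row of $\lambda$. $(a;q)_\infty=\prod_{i\ge 0}(1-aq^i)$ for $|q|<1$, and $(a;q)_\infty^m$ means $\big((a;q)_\infty\big)^m$; the identity may be read as one of formal power series in $q$. *)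

theory Defs
  imports "HOL-Analysis.Analysis"
begin

text \<open>
  A strict partition is the list of its parts, in decreasing order. Rows are numbered from 0,
  so row \<open>i\<close> of \<open>lam\<close> is meaningful for \<open>i < length lam\<close>.
\<close>

definition strict_partition :: "nat list \<Rightarrow> bool" where
  "strict_partition lam \<longleftrightarrow> sorted_wrt (>) lam \<and> (\<forall>x\<in>set lam. 0 < x)"

definition bar_lengths :: "nat list \<Rightarrow> nat \<Rightarrow> nat set" where
  "bar_lengths lam i =
     {lam ! i + lam ! j | j. i < j \<and> j < length lam} \<union>
     ({1..lam ! i} - {lam ! i - lam ! j | j. i < j \<and> j < length lam})"

definition bar_core :: "nat \<Rightarrow> nat list \<Rightarrow> bool" where
  "bar_core s lam \<longleftrightarrow> strict_partition lam \<and> (\<forall>i<length lam. s \<notin> bar_lengths lam i)"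

definition bar_core_partitions :: "nat \<Rightarrow> nat \<Rightarrow> nat list set" where
  "bar_core_partitions s n = {lam. bar_core s lam \<and> sum_list lam = n}"

definition bc :: "nat \<Rightarrow> nat \<Rightarrow> nat" where
  "bc s n = card (bar_core_partitions s n)"

definition qpoch_inf :: "complex \<Rightarrow> complex \<Rightarrow> complex" where
  "qpoch_inf a q = (\<Prod>i. 1 - a * q ^ i)"

lemma finite_bar_core_partitions: "finite (bar_core_partitions s n)"
proof (rule finite_subset)
  show "bar_core_partitions s n \<subseteq> {lam. set lam \<subseteq> {..n} \<and> distinct lam}"
  proof
    fix lam assume "lam \<in> bar_core_partitions s n"
    then have sorted: "sorted_wrt (>) lam" and n: "sum_list lam = n"
      by (auto simp: bar_core_partitions_def bar_core_def strict_partition_def)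
    have "distinct lam"
      using sorted by (induction lam) auto
    moreover have "set lam \<subseteq> {..n}"
      using member_le_sum_list n by blast
    ultimately show "lam \<in> {lam. set lam \<subseteq> {..n} \<and> distinct lam}" by simp
  qed
  show "finite {lam. set lam \<subseteq> {..n} \<and> distinct lam}"
    by (rule finite_subset_distinct) simp
qed

end

theory Submission imports Defs begin

text \<open>
  Write \<open>s = 2 t\<close> and describe a strict partition by its set of parts. That \<open>s\<close> is not a bar length
  means: \<open>s\<close> is not a part, with a part \<open>a > s\<close> also \<open>a - s\<close> is a part, and no two different parts
  add up to \<open>s\<close>. So no part is divisible by \<open>s\<close>; in each other residue class \<open>r\<close> modulo \<open>s\<close> the parts
  form a run \<open>r\<close>, \<open>r + s\<close>, ..., \<open>r + (k - 1) s\<close>; and of the runs in the residues \<open>r\<close> and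
  \<open>s - r\<close> with \<open>0 < r < t\<close> at most one is nonempty. There are no further conditions
  (\<open>bij_betw_bar_core_sets\<close>), so the generating function is a product over \<open>r \<in> {1..t}\<close>
  (\<open>bc_sums_prod_class_runs\<close>).

  A run of length \<open>k\<close> has size \<open>r k + s k(k-1)/2\<close>, and replacing \<open>r\<close> by \<open>s - r\<close> amounts to replacing
  \<open>k\<close> by \<open>- k\<close>. For \<open>r < t\<close> the factor is therefore the theta series of \<open>q^(r k + s k(k-1)/2)\<close> over all
  integers \<open>k\<close>, which by the Jacobi triple product is
  \<open>(q\<^sup>s;q\<^sup>s)\<^sub>\<infinity> (-q\<^sup>r;q\<^sup>s)\<^sub>\<infinity> (-q^(s-r);q\<^sup>s)\<^sub>\<infinity>\<close>. For \<open>r = t\<close> there is one residue only, the size is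
  \<open>t k\<^sup>2\<close> with \<open>k \<ge> 0\<close>, and the factor is the sum that remains in the formula. The factors
  \<open>1 + q\<^sup>i\<close> that occur for \<open>r < t\<close> are those where \<open>t\<close> does not divide \<open>i\<close>
  (\<open>qpoch_inf_pair_residues\<close>), hence the quotient \<open>(-q;q)\<^sub>\<infinity> / (-q\<^sup>t;q\<^sup>t)\<^sub>\<infinity>\<close>.

  The triple product (\<open>jacobi_triple_product\<close>) is obtained as the limit of a finite identity with
  Gaussian binomial coefficients, where Tannery's theorem justifies taking the limit term by term.
\<close>

section \<open>Partial and infinite products\<close>

definition qpoch :: "complex \<Rightarrow> complex \<Rightarrow> nat \<Rightarrow> complex" where
  "qpoch a q n = (\<Prod>i<n. 1 - a * q ^ i)"

lemma qpoch_0 [simp]: "qpoch a q 0 = 1"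
  by (simp add: qpoch_def)

lemma qpoch_Suc: "qpoch a q (Suc n) = qpoch a q n * (1 - a * q ^ n)"
  by (simp add: qpoch_def)

lemma qpoch_factor_nonzero:
  fixes a q :: complex
  assumes "norm a < 1" "norm q < 1"
  shows "1 - a * q ^ i \<noteq> 0"
proof
  assume "1 - a * q ^ i = 0"
  then have "norm a * norm q ^ i = 1"
    by (metis eq_iff_diff_eq_0 norm_mult norm_one norm_power)
  moreover have "norm a * norm q ^ i \<le> norm a * 1"
    using assms by (intro mult_left_mono power_le_one) auto
  ultimately show False
    using assms by simp
qed

lemma qpoch_nonzero:
  assumes "norm a < 1" "norm q < 1"
  shows "qpoch a q n \<noteq> 0"
  using qpoch_factor_nonzero[OF assms] by (simp add: qpoch_def)

lemma convergent_prod_qpoch: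
  fixes a q :: complex
  assumes "norm q < 1"
  shows "convergent_prod (\<lambda>i. 1 - a * q ^ i)"
proof -
  have "summable (\<lambda>i. norm a * norm q ^ i)"
    using assms by (intro summable_mult summable_geometric) simp
  then have "abs_convergent_prod (\<lambda>i. 1 - a * q ^ i)"
    by (intro summable_imp_abs_convergent_prod) (simp add: norm_mult norm_power)
  then show ?thesis
    by (rule abs_convergent_prod_imp_convergent_prod)
qed

lemma qpoch_LIMSEQ:
  assumes "norm q < 1"
  shows "qpoch a q \<longlonglongrightarrow> qpoch_inf a q"
proof -
  have "(\<lambda>n. qpoch a q (Suc n)) \<longlonglongrightarrow> qpoch_inf a q"
    using convergent_prod_LIMSEQ[OF convergent_prod_qpoch[OF assms]]
    by (simp add: qpoch_def qpoch_inf_def lessThan_Suc_atMost)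
  then show ?thesis
    by (rule LIMSEQ_imp_Suc)
qed

lemma qpoch_inf_nonzero:
  assumes "norm a < 1" "norm q < 1"
  shows "qpoch_inf a q \<noteq> 0"
  unfolding qpoch_inf_def
  using assms by (intro prodinf_nonzero convergent_prod_qpoch qpoch_factor_nonzero)

text \<open>
  Sorting the factors by the residue of the exponent modulo \<open>m\<close>; for the partial products of
  length \<open>N * m\<close> this is an exact regrouping.
\<close>

lemma qpoch_inf_dissect:
  assumes q: "norm q < 1" and m: "m > 0"
  shows "qpoch_inf a q = (\<Prod>r<m. qpoch_inf (a * q ^ r) (q ^ m))"
proof -
  have fin: "qpoch a q (N * m) = (\<Prod>r<m. qpoch (a * q ^ r) (q ^ m) N)" for N
  proof (induction N)
    case (Suc N)
    have "qpoch a q (Suc N * m) = qpoch a q (N * m) * (\<Prod>i=N*m..<N*m+m. 1 - a * q ^ i)"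
      unfolding qpoch_def lessThan_atLeast0
      by (subst prod.atLeastLessThan_concat) (simp_all add: add.commute)
    also have "(\<Prod>i=N*m..<N*m+m. 1 - a * q ^ i) = (\<Prod>r<m. 1 - a * q ^ r * (q ^ m) ^ N)"
      by (rule prod.reindex_bij_witness[of _ "\<lambda>r. r + N * m" "\<lambda>i. i - N * m"])
        (auto simp: power_add[symmetric] power_mult[symmetric] mult.assoc mult.commute)
    finally show ?case
      by (simp add: Suc.IH qpoch_Suc prod.distrib)
  qed simp
  have "(\<lambda>N. qpoch a q (N * m)) \<longlonglongrightarrow> qpoch_inf a q"
    using qpoch_LIMSEQ[OF q] m
    by (rule filterlim_compose[OF _ mult_nat_right_at_top])
  moreover have "(\<lambda>N. \<Prod>r<m. qpoch (a * q ^ r) (q ^ m) N)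
      \<longlonglongrightarrow> (\<Prod>r<m. qpoch_inf (a * q ^ r) (q ^ m))"
    using q m by (intro tendsto_prod qpoch_LIMSEQ) (simp add: norm_power power_less_one_iff)
  ultimately show ?thesis
    unfolding fin using LIMSEQ_unique by blast
qed

section \<open>Gaussian binomial coefficients\<close>

text \<open>
  The quotient is meaningful because \<open>(x;x)\<^sub>n\<close> does not vanish for \<open>norm x < 1\<close>. The value \<open>0\<close> for
  \<open>j > n\<close> makes the Pascal rules below hold at the boundary as well, and lets finite sums be
  read as infinite series.
\<close>

definition gauss_binomial :: "complex \<Rightarrow> nat \<Rightarrow> nat \<Rightarrow> complex" where
  "gauss_binomial x n j =
     (if j \<le> n then qpoch x x n / (qpoch x x j * qpoch x x (n - j)) else 0)"

lemma gauss_binomial_gt [simp]: "j > n \<Longrightarrow> gauss_binomial x n j = 0"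
  by (simp add: gauss_binomial_def)

lemma gauss_binomial_symmetric:
  "j \<le> n \<Longrightarrow> gauss_binomial x n (n - j) = gauss_binomial x n j"
  by (simp add: gauss_binomial_def mult.commute)

lemma gauss_binomial_0 [simp]: "norm x < 1 \<Longrightarrow> gauss_binomial x n 0 = 1"
  by (simp add: gauss_binomial_def qpoch_nonzero)

lemma gauss_binomial_self [simp]: "norm x < 1 \<Longrightarrow> gauss_binomial x n n = 1"
  by (simp add: gauss_binomial_def qpoch_nonzero)

text \<open>
  The \<open>x\<close>-analogue of Pascal's rule comes in two mirror images, exchanged by
  \<open>j \<mapsto> n - j\<close>. The induction for the finite triple product uses this one for the
  factor \<open>1 + a x\<^sup>N\<close> and the other one for the factor \<open>1 + b x\<^sup>N\<close>.
\<close>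

lemma gauss_binomial_Suc:
  assumes x: "norm x < 1" and "j \<le> n"
  shows "gauss_binomial x (Suc n) (Suc j) =
    gauss_binomial x n (Suc j) + x ^ (n - j) * gauss_binomial x n j"
proof (cases "j = n")
  case True
  then show ?thesis using x by simp
next
  case False
  with \<open>j \<le> n\<close> obtain i where n: "n = Suc (i + j)"
    by (metis le_neq_implies_less less_imp_Suc_add add.commute)
  have nz: "qpoch x x m \<noteq> 0" "1 - x * x ^ m \<noteq> 0" for m
    using qpoch_nonzero[OF x x] qpoch_factor_nonzero[OF x x] by blast+
  \<comment> \<open>Over the common denominator the claim is \<open>1 - x^(i+j+2) = (1 - x^(i+1)) + x^(i+1) (1 - x^(j+1))\<close>.\<close>
  have "n - j = Suc i" "Suc n - Suc j = Suc i" "n - Suc j = i" "Suc j \<le> n" "Suc j \<le> Suc n"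
    using n by auto
  then show ?thesis
    using nz(1)[of "n"] nz(1)[of i] nz(1)[of j] nz(2)[of i] nz(2)[of j]
    apply (simp add: gauss_binomial_def qpoch_Suc \<open>j \<le> n\<close>)
    apply (simp add: divide_simps)
    apply (simp add: n power_add algebra_simps)
    done
qed

lemma gauss_binomial_Suc':
  assumes x: "norm x < 1" and "j \<le> n"
  shows "gauss_binomial x (Suc n) (Suc j) =
    x ^ Suc j * gauss_binomial x n (Suc j) + gauss_binomial x n j"
proof (cases "j = n")
  case True
  then show ?thesis using x by simp
next
  case False
  with \<open>j \<le> n\<close> have le: "Suc j \<le> n" by simp
  define i where "i = n - Suc j"
  have i: "i \<le> n" "Suc n - Suc j = Suc i" "n - Suc j = i" "n - j = Suc i" "n - i = Suc j"
    using le by (auto simp: i_def)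
  have "gauss_binomial x (Suc n) (Suc j) = gauss_binomial x (Suc n) (Suc i)"
    using gauss_binomial_symmetric[of "Suc j" "Suc n" x] le i by simp
  also have "\<dots> = gauss_binomial x n (n - j) + x ^ Suc j * gauss_binomial x n (n - Suc j)"
    using gauss_binomial_Suc[OF x \<open>i \<le> n\<close>] i by simp
  finally show ?thesis
    using gauss_binomial_symmetric le \<open>j \<le> n\<close> by simp
qed

section \<open>The Jacobi triple product\<close>

text \<open>
  In Ramanujan's form the theta series has two parameters \<open>a\<close>, \<open>b\<close> with \<open>a * b\<close> as its base, and
  its term of index \<open>k \<in> \<int>\<close> is \<open>a^(k(k+1)/2) b^(k(k-1)/2)\<close>. Written with \<open>a * b\<close> this is
  \<open>a^k (a b)^(k choose 2)\<close> for \<open>k \<ge> 0\<close>, and the same with \<open>b\<close> and \<open>- k\<close> for \<open>k < 0\<close>; so there are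
  no negative powers and the degenerate case \<open>a = 0\<close> or \<open>b = 0\<close> is included. Below,
  \<open>theta_term a b N j\<close> is the term of index \<open>k = j - N\<close>, which turns the range
  \<open>{- N..N}\<close> of \<open>k\<close> into the range \<open>{..2 * N}\<close> of \<open>j\<close>.
\<close>

definition theta_term :: "complex \<Rightarrow> complex \<Rightarrow> nat \<Rightarrow> nat \<Rightarrow> complex" where
  "theta_term a b N j =
     (if N \<le> j then a ^ (j - N) * (a * b) ^ ((j - N) choose 2)
      else b ^ (N - j) * (a * b) ^ ((N - j) choose 2))"

lemma choose_two_Suc: "Suc k choose 2 = k + (k choose 2)"
  by (simp add: numeral_2_eq_2)

lemma theta_term_Suc_Suc [simp]: "theta_term a b (Suc N) (Suc j) = theta_term a b N j"
  by (simp add: theta_term_def)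

text \<open>
  Consecutive terms have ratio \<open>a x^k\<close>, where \<open>x = a b\<close> and \<open>k = j - N\<close>. Hence multiplication by
  \<open>a x\<^sup>N\<close> raises the index and leaves the factor \<open>x^(N - k)\<close>, the weight that occurs in the first
  Pascal rule.
\<close>

lemma theta_term_shift_up:
  assumes "j \<le> 2 * N"
  shows "a * (a * b) ^ N * theta_term a b N j = (a * b) ^ (2 * N - j) * theta_term a b N (Suc j)"
proof (cases "N \<le> j")
  case True
  then obtain k where j: "j = N + k"
    using le_Suc_ex by blast
  then obtain i where N: "N = k + i"
    using assms le_Suc_ex[of k N] by auto
  have "2 * N - j = i" "j - N = k" "Suc j - N = Suc k"
    using j N by auto
  then show ?thesis
    using True N by (simp add: theta_term_def choose_two_Suc power_add algebra_simps)
next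
  case False
  define k where "k = N - Suc j"
  have N: "2 * N - j = Suc N + k" and k: "N - j = Suc k"
    using False by (auto simp: k_def)
  have "a * (a * b) ^ N * theta_term a b N j
      = (a * b) ^ Suc N * (a * b) ^ k * (b ^ k * (a * b) ^ (k choose 2))"
    using False k by (simp add: theta_term_def choose_two_Suc power_add algebra_simps)
  also have "b ^ k * (a * b) ^ (k choose 2) = theta_term a b N (Suc j)"
    using False by (auto simp: theta_term_def k_def)
  finally show ?thesis
    by (simp add: N power_add)
qed

text \<open>
  In the same way \<open>b x\<^sup>N\<close> lowers the index and leaves \<open>x^(N + k)\<close>. The lowered index \<open>j - N - 1\<close> is
  expressed by increasing \<open>N\<close>, since \<open>j - 1\<close> would be truncated at \<open>j = 0\<close>.
\<close>

lemma theta_term_shift_down: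
  assumes "j \<le> Suc (2 * N)"
  shows "b * (a * b) ^ N * theta_term a b N j = (a * b) ^ j * theta_term a b (Suc N) j"
proof (cases "N < j")
  case True
  define k where "k = j - Suc N"
  have j: "j = Suc N + k" and k: "j - N = Suc k"
    using True by (auto simp: k_def)
  show ?thesis
    using True k unfolding theta_term_def j
    by (simp add: choose_two_Suc power_add algebra_simps)
next
  case False
  define k where "k = N - j"
  have N: "N = j + k"
    using False by (auto simp: k_def)
  show ?thesis
    unfolding theta_term_def N
    by (simp add: choose_two_Suc power_add algebra_simps)
qed

text \<open>
  Both sides change in the same way when \<open>N\<close> grows: the new factor \<open>1 + a x\<^sup>N\<close> moves the
  coefficients from row \<open>2 N\<close> of the Gaussian triangle to row \<open>2 N + 1\<close>, and the new factor
  \<open>1 + b x\<^sup>N\<close> moves them on to row \<open>2 N + 2\<close>.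
\<close>

lemma finite_jacobi_triple_product:
  assumes "norm (a * b) < 1"
  shows "qpoch (- a) (a * b) N * qpoch (- b) (a * b) N =
    (\<Sum>j\<le>2 * N. gauss_binomial (a * b) (2 * N) j * theta_term a b N j)"
proof (induction N)
  case 0
  then show ?case by (simp add: gauss_binomial_def theta_term_def binomial_eq_0)
next
  case (Suc N)
  define x where "x = a * b"
  define g where "g = gauss_binomial x"
  define th where "th = theta_term a b"
  have x: "norm x < 1" using assms by (simp add: x_def)
  have up: "a * x ^ N * th N j = x ^ (2 * N - j) * th N (Suc j)" if "j \<le> 2 * N" for j
    using theta_term_shift_up[OF that] by (simp add: x_def th_def)
  have down: "b * x ^ N * th N j = x ^ j * th (Suc N) j" if "j \<le> Suc (2 * N)" for j
    using theta_term_shift_down[OF that] by (simp add: x_def th_def)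
  have "(\<Sum>j\<le>2 * N. g (2 * N) j * th N j) = (\<Sum>j\<le>Suc (2 * N). g (2 * N) j * th N j)"
    by (simp add: g_def)
  also have "\<dots> = th N 0 + (\<Sum>j\<le>2 * N. g (2 * N) (Suc j) * th N (Suc j))"
    using x by (subst sum.atMost_Suc_shift) (simp add: g_def)
  finally have peel: "(\<Sum>j\<le>2 * N. g (2 * N) j * th N j)
      = th N 0 + (\<Sum>j\<le>2 * N. g (2 * N) (Suc j) * th N (Suc j))" .
  \<comment> \<open>Raising the index shifts one copy of the row by one place; adding it to the unshifted copy is
    the Pascal rule.\<close>
  have "(1 + a * x ^ N) * (\<Sum>j\<le>2 * N. g (2 * N) j * th N j)
      = (\<Sum>j\<le>2 * N. g (2 * N) j * th N j)
        + (\<Sum>j\<le>2 * N. g (2 * N) j * (a * x ^ N * th N j))"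
    by (subst distrib_right) (simp add: sum_distrib_left mult_ac del: sum.atMost_Suc)
  also have "(\<Sum>j\<le>2 * N. g (2 * N) j * (a * x ^ N * th N j))
      = (\<Sum>j\<le>2 * N. x ^ (2 * N - j) * g (2 * N) j * th N (Suc j))"
    by (intro sum.cong refl) (simp add: up)
  also have "(\<Sum>j\<le>2 * N. g (2 * N) j * th N j) + \<dots>
      = th N 0 + (\<Sum>j\<le>2 * N. g (Suc (2 * N)) (Suc j) * th N (Suc j))"
    unfolding peel by (simp add: g_def gauss_binomial_Suc[OF x] distrib_right sum.distrib)
  also have "\<dots> = (\<Sum>j\<le>Suc (2 * N). g (Suc (2 * N)) j * th N j)"
    using x by (subst sum.atMost_Suc_shift) (simp add: g_def)
  finally have step1: "(1 + a * x ^ N) * (\<Sum>j\<le>2 * N. g (2 * N) j * th N j)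
      = (\<Sum>j\<le>Suc (2 * N). g (Suc (2 * N)) j * th N j)" .
  \<comment> \<open>Lowering the index is written relative to \<open>Suc N\<close>, where the unshifted copy is the one that
    moves: \<open>th N j = th (Suc N) (Suc j)\<close>.\<close>
  let ?M = "Suc (2 * N)"
  have "(1 + b * x ^ N) * (\<Sum>j\<le>?M. g ?M j * th N j)
      = (\<Sum>j\<le>?M. g ?M j * th N j) + (\<Sum>j\<le>?M. g ?M j * (b * x ^ N * th N j))"
    by (subst distrib_right) (simp add: sum_distrib_left mult_ac del: sum.atMost_Suc)
  also have "(\<Sum>j\<le>?M. g ?M j * (b * x ^ N * th N j)) = (\<Sum>j\<le>?M. x ^ j * g ?M j * th (Suc N) j)"
    by (intro sum.cong refl) (simp add: down)
  also have "\<dots> = (\<Sum>j\<le>Suc ?M. x ^ j * g ?M j * th (Suc N) j)"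
    by (simp add: g_def)
  also have "\<dots> = th (Suc N) 0 + (\<Sum>j\<le>?M. x ^ Suc j * g ?M (Suc j) * th (Suc N) (Suc j))"
    using x by (subst sum.atMost_Suc_shift) (simp add: g_def)
  also have "(\<Sum>j\<le>?M. g ?M j * th N j) + \<dots>
      = th (Suc N) 0 + (\<Sum>j\<le>?M. g (Suc ?M) (Suc j) * th (Suc N) (Suc j))"
    by (simp add: g_def th_def gauss_binomial_Suc'[OF x] distrib_right sum.distrib 
         del: power_Suc sum.atMost_Suc)
  also have "\<dots> = (\<Sum>j\<le>Suc ?M. g (Suc ?M) j * th (Suc N) j)"
    using x by (subst sum.atMost_Suc_shift) (simp add: g_def)
  finally have step2: "(1 + b * x ^ N) * (\<Sum>j\<le>?M. g ?M j * th N j)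
      = (\<Sum>j\<le>Suc ?M. g (Suc ?M) j * th (Suc N) j)" .
  have "qpoch (- a) x (Suc N) * qpoch (- b) x (Suc N)
      = (1 + b * x ^ N) * ((1 + a * x ^ N) * (\<Sum>j\<le>2 * N. g (2 * N) j * th N j))"
    using Suc.IH by (simp add: qpoch_Suc x_def g_def th_def)
  then show ?case
    unfolding step1 step2 by (simp add: x_def g_def th_def)
qed

text \<open>
  Near the middle of a long row all three products in the Gaussian binomial are long, so each of
  them tends to \<open>(x;x)\<^sub>\<infinity>\<close>.
\<close>

lemma gauss_binomial_central_LIMSEQ:
  assumes x: "norm x < 1"
  shows "(\<lambda>N. gauss_binomial x (2 * N) (N + k)) \<longlonglongrightarrow> 1 / qpoch_inf x x"
proof -
  let ?L = "qpoch_inf x x"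
  have L: "?L \<noteq> 0"
    using qpoch_inf_nonzero[OF x x] .
  have lim: "(\<lambda>N. qpoch x x (h N)) \<longlonglongrightarrow> ?L" if "filterlim h at_top sequentially" for h
    using qpoch_LIMSEQ[OF x] that by (rule filterlim_compose)
  have "filterlim (\<lambda>N::nat. 2 * N) at_top sequentially"
    by (rule mult_nat_left_at_top) simp
  moreover have "filterlim (\<lambda>N. N + k) at_top sequentially"
    by (rule filterlim_add_const_nat_at_top)
  moreover have "filterlim (\<lambda>N. N - k) at_top sequentially"
    by (rule filterlim_minus_const_nat_at_top)
  ultimately have "(\<lambda>N. qpoch x x (2 * N) / (qpoch x x (N + k) * qpoch x x (N - k)))
      \<longlonglongrightarrow> ?L / (?L * ?L)"
    using L by (intro tendsto_divide tendsto_mult lim) auto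
  moreover have "eventually (\<lambda>N. qpoch x x (2 * N) / (qpoch x x (N + k) * qpoch x x (N - k))
      = gauss_binomial x (2 * N) (N + k)) sequentially"
    using eventually_ge_at_top[of k]
    by eventually_elim (simp add: gauss_binomial_def mult_2)
  ultimately show ?thesis
    using L by (simp add: tendsto_cong)
qed

text \<open>
  The sequence \<open>(x;x)\<^sub>n\<close> converges to a nonzero limit without vanishing, so it and its inverse are
  bounded. This uniform bound is what dominated convergence needs.
\<close>

lemma gauss_binomial_bounded:
  assumes x: "norm x < 1"
  obtains C where "\<And>n j. norm (gauss_binomial x n j) \<le> C"
proof -
  have "Bseq (qpoch x x)"
    using qpoch_LIMSEQ[OF x] by (intro convergent_imp_Bseq convergentI)
  then obtain K where K: "K > 0" "\<And>n. norm (qpoch x x n) \<le> K"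
    by (auto elim!: BseqE)
  have "(\<lambda>n. inverse (qpoch x x n)) \<longlonglongrightarrow> inverse (qpoch_inf x x)"
    using qpoch_LIMSEQ[OF x] qpoch_inf_nonzero[OF x x] by (rule tendsto_inverse)
  then have "Bseq (\<lambda>n. inverse (qpoch x x n))"
    by (intro convergent_imp_Bseq convergentI)
  then obtain K' where K': "K' > 0" "\<And>n. norm (inverse (qpoch x x n)) \<le> K'"
    by (auto elim!: BseqE)
  have "norm (gauss_binomial x n j) \<le> K * (K' * K')" for n j
  proof (cases "j \<le> n")
    case True
    then have "norm (gauss_binomial x n j) = norm (qpoch x x n) *
        (norm (inverse (qpoch x x j)) * norm (inverse (qpoch x x (n - j))))"
      by (simp add: gauss_binomial_def norm_mult norm_divide norm_inverse divide_inverse)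
    also have "\<dots> \<le> K * (K' * K')"
      using K K' by (intro mult_mono) (auto intro: less_imp_le)
    finally show ?thesis .
  next
    case False
    then show ?thesis using K(1) K'(1) by simp
  qed
  then show thesis by (rule that)
qed

lemma norm_theta_summand_le:
  fixes a b :: complex
  assumes "norm a < 1" "norm b < 1"
  shows "norm (a ^ k * (a * b) ^ (k choose 2)) \<le> norm a ^ k"
proof -
  have "norm (a * b) \<le> 1"
    using assms by (simp add: norm_mult mult_le_one)
  then have "norm ((a * b) ^ (k choose 2)) \<le> 1"
    by (simp add: norm_power power_le_one)
  then show ?thesis
    by (simp add: norm_mult norm_power mult_left_le)
qed

lemma summable_norm_theta:
  fixes a b :: complex
  assumes "norm a < 1" "norm b < 1"
  shows "summable (\<lambda>k. norm (a ^ k * (a * b) ^ (k choose 2)))"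
proof (rule summable_comparison_test')
  show "summable (\<lambda>k. norm a ^ k)"
    using assms by (intro summable_geometric) simp
  show "\<And>k. k \<ge> 0 \<Longrightarrow> norm (norm (a ^ k * (a * b) ^ (k choose 2))) \<le> norm a ^ k"
    using norm_theta_summand_le[OF assms] by simp
qed

text \<open>
  The terms of index \<open>k\<close> and \<open>- k\<close> together; the term of index \<open>0\<close> is counted once.
\<close>

definition two_sided_theta :: "complex \<Rightarrow> complex \<Rightarrow> nat \<Rightarrow> complex" where
  "two_sided_theta a b k =
     a ^ k * (a * b) ^ (k choose 2) + (if k = 0 then 0 else b ^ k * (a * b) ^ (k choose 2))"

text \<open>
  Because of the symmetry of the Gaussian binomials the terms of index \<open>k\<close> and \<open>- k\<close> carry the same
  coefficient. Folding the sum at its middle gives a series over the naturals, to which Tannery's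
  theorem applies.
\<close>

lemma finite_jacobi_triple_product_folded:
  assumes "norm (a * b) < 1"
  shows "(\<lambda>k. gauss_binomial (a * b) (2 * N) (N + k) * two_sided_theta a b k) sums
    (qpoch (- a) (a * b) N * qpoch (- b) (a * b) N)"
proof -
  define g where "g = gauss_binomial (a * b) (2 * N)"
  define P where "P = (\<lambda>k. a ^ k * (a * b) ^ (k choose 2))"
  define M where "M = (\<lambda>k. if k = 0 then 0 else b ^ k * (a * b) ^ (k choose 2))"
  have g_sym: "g (N + (N - j)) = g j" if "j < N" for j
    using gauss_binomial_symmetric[of j "2 * N" "a * b"] that
    by (simp add: g_def mult_2)
  have "qpoch (- a) (a * b) N * qpoch (- b) (a * b) N
      = (\<Sum>j\<le>2 * N. g j * theta_term a b N j)"
    by (simp add: finite_jacobi_triple_product[OF assms] g_def)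
  also have "{..2 * N} = {N..2 * N} \<union> {..<N}"
    by auto
  also have "(\<Sum>j\<in>{N..2 * N} \<union> {..<N}. g j * theta_term a b N j)
      = (\<Sum>j\<in>{N..2 * N}. g j * theta_term a b N j) + (\<Sum>j<N. g j * theta_term a b N j)"
    by (rule sum.union_disjoint) auto
  also have "(\<Sum>j\<in>{N..2 * N}. g j * theta_term a b N j) = (\<Sum>k\<le>N. g (N + k) * P k)"
    by (rule sum.reindex_bij_witness[of _ "\<lambda>k. N + k" "\<lambda>j. j - N"])
      (auto simp: theta_term_def P_def)
  also have "(\<Sum>j<N. g j * theta_term a b N j) = (\<Sum>k\<in>{1..N}. g (N + k) * M k)"
    by (rule sum.reindex_bij_witness[of _ "\<lambda>k. N - k" "\<lambda>j. N - j"])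
      (auto simp: theta_term_def M_def g_sym simp del: add_diff_assoc)
  also have "\<dots> = (\<Sum>k\<le>N. g (N + k) * M k)"
    by (rule sum.mono_neutral_left) (auto simp: M_def)
  also have "(\<Sum>k\<le>N. g (N + k) * P k) + \<dots> = (\<Sum>k\<le>N. g (N + k) * two_sided_theta a b k)"
    by (simp add: two_sided_theta_def P_def M_def sum.distrib distrib_left)
  finally have eq: "qpoch (- a) (a * b) N * qpoch (- b) (a * b) N = \<dots>" .
  show ?thesis
    unfolding eq using sums_finite[of "{..N}" "\<lambda>k. g (N + k) * two_sided_theta a b k"]
    by (simp add: g_def)
qed

text \<open>
  Let \<open>N\<close> tend to infinity in the finite identity: the products tend to the infinite products and
  each coefficient tends to \<open>1 / (x;x)\<^sub>\<infinity>\<close>, while the terms stay dominated by a geometric series.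
\<close>

theorem jacobi_triple_product:
  assumes a: "norm a < 1" and b: "norm b < 1"
  shows "two_sided_theta a b sums
    (qpoch_inf (a * b) (a * b) * qpoch_inf (- a) (a * b) * qpoch_inf (- b) (a * b))"
proof -
  define x where "x = a * b"
  define L where "L = qpoch_inf x x"
  have x: "norm x < 1"
    using a b mult_strict_mono[of "norm a" 1 "norm b" 1] by (simp add: x_def norm_mult)
  have L: "L \<noteq> 0"
    using qpoch_inf_nonzero[OF x x] by (simp add: L_def)
  obtain C where C: "\<And>n j. norm (gauss_binomial x n j) \<le> C"
    using gauss_binomial_bounded[OF x] by blast
  define M where "M k = C * (norm a ^ k + norm b ^ k)" for k
  have theta_bound: "norm (two_sided_theta a b k) \<le> norm a ^ k + norm b ^ k" for k
    unfolding two_sided_theta_def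
    using norm_theta_summand_le[OF a b, of k] norm_theta_summand_le[OF b a, of k]
    by (intro norm_triangle_le add_mono) (auto simp: mult.commute[of b a])
  have M: "summable M"
    unfolding M_def using a b by (intro summable_mult summable_add summable_geometric) auto
  have bound: "norm (gauss_binomial x (2 * N) (N + k) * two_sided_theta a b k) \<le> M k" for N k
    unfolding M_def norm_mult
    using C order_trans[OF norm_ge_zero C] theta_bound by (intro mult_mono) auto
  have "summable (\<lambda>k. norm (1 / L * two_sided_theta a b k)) \<and>
    (\<lambda>N. \<Sum>k. gauss_binomial x (2 * N) (N + k) * two_sided_theta a b k)
      \<longlonglongrightarrow> (\<Sum>k. 1 / L * two_sided_theta a b k)"
  proof (rule conjunct2[OF tannerys_theorem])
    show "(\<lambda>N. gauss_binomial x (2 * N) (N + k) * two_sided_theta a b k)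
        \<longlonglongrightarrow> 1 / L * two_sided_theta a b k" for k
      unfolding L_def by (intro tendsto_intros gauss_binomial_central_LIMSEQ x)
    show "\<forall>\<^sub>F (k, N) in at_top \<times>\<^sub>F sequentially.
        norm (gauss_binomial x (2 * N) (N + k) * two_sided_theta a b k) \<le> M k"
      using bound by (intro always_eventually) auto
  qed (use M in auto)
  moreover have "(\<lambda>N. \<Sum>k. gauss_binomial x (2 * N) (N + k) * two_sided_theta a b k)
      = (\<lambda>N. qpoch (- a) x N * qpoch (- b) x N)"
    using finite_jacobi_triple_product_folded[of a b] x by (simp add: x_def sums_iff)
  moreover have "(\<lambda>N. qpoch (- a) x N * qpoch (- b) x N)
      \<longlonglongrightarrow> qpoch_inf (- a) x * qpoch_inf (- b) x"
    by (intro tendsto_mult qpoch_LIMSEQ x)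
  ultimately have "(\<lambda>k. 1 / L * two_sided_theta a b k) sums
      (qpoch_inf (- a) x * qpoch_inf (- b) x)"
    by (metis LIMSEQ_unique summable_norm_cancel summable_sums)
  from sums_mult[OF this, of L] show ?thesis
    using L by (simp add: L_def x_def mult.assoc)
qed

section \<open>Bar cores as sets of parts\<close>

text \<open>
  The core condition in terms of the set of parts: a part \<open>a > s\<close> can only avoid the bar length \<open>s\<close>
  if \<open>a - s\<close> is a part too, and \<open>s\<close> itself can never avoid it because \<open>0\<close> is not a part.
\<close>

definition bar_core_set :: "nat \<Rightarrow> nat set \<Rightarrow> bool" where
  "bar_core_set s A \<longleftrightarrow> finite A \<and> 0 \<notin> A \<and> s \<notin> A \<and> (\<forall>a\<in>A. s < a \<longrightarrow> a - s \<in> A) \<and>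
     (\<forall>a\<in>A. \<forall>b\<in>A. a \<noteq> b \<longrightarrow> a + b \<noteq> s)"

lemma strict_partition_distinct: "strict_partition lam \<Longrightarrow> distinct lam"
  by (auto simp: strict_partition_def distinct_conv_nth sorted_wrt_iff_nth_less
        nat_neq_iff)

lemma strict_partition_nth_less_iff:
  assumes "strict_partition lam" "i < length lam" "j < length lam"
  shows "lam ! j < lam ! i \<longleftrightarrow> i < j"
  using assms unfolding strict_partition_def sorted_wrt_iff_nth_less
  by (metis less_asym' linorder_neqE_nat)

lemma bar_core_iff_bar_core_set:
  assumes lam: "strict_partition lam" and s: "s > 0"
  shows "bar_core s lam \<longleftrightarrow> bar_core_set s (set lam)"
proof
  note less_iff = strict_partition_nth_less_iff[OF lam]
  have pos: "0 \<notin> set lam"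
    using lam by (auto simp: strict_partition_def)
  assume "bar_core s lam"
  then have core: "s \<notin> bar_lengths lam i" if "i < length lam" for i
    using that by (simp add: bar_core_def)
  have down: "a - s \<in> set lam" if a: "a \<in> set lam" "s \<le> a" for a
  proof -
    obtain i where i: "i < length lam" "lam ! i = a"
      using a(1) by (auto simp: in_set_conv_nth)
    then obtain j where j: "j < length lam" "i < j" "s = lam ! i - lam ! j"
      using core[OF i(1)] s a by (auto simp: bar_lengths_def)
    then have "a - s = lam ! j"
      using less_iff[of i j] i by simp
    then show ?thesis using j by simp
  qed
  have "s \<notin> set lam"
    using down[of s] pos by auto
  moreover have "a + b \<noteq> s" if ab: "a \<in> set lam" "b \<in> set lam" "a < b" for a b
  proof -
    obtain i j where ij: "i < length lam" "lam ! i = b" "j < length lam" "lam ! j = a"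
      using ab(1,2) by (metis in_set_conv_nth)
    then have "i < j"
      using less_iff ab(3) by blast
    then show ?thesis
      using core[OF ij(1)] ij by (auto simp: bar_lengths_def add.commute)
  qed
  then have "\<forall>a\<in>set lam. \<forall>b\<in>set lam. a \<noteq> b \<longrightarrow> a + b \<noteq> s"
    by (metis add.commute linorder_neqE_nat)
  ultimately show "bar_core_set s (set lam)"
    using pos down by (auto simp: bar_core_set_def)
next
  note less_iff = strict_partition_nth_less_iff[OF lam]
  assume core: "bar_core_set s (set lam)"
  have "s \<notin> bar_lengths lam i" if i: "i < length lam" for i
  proof
    assume "s \<in> bar_lengths lam i"
    then consider (add) j where "i < j" "j < length lam" "s = lam ! i + lam ! j"
      | (sub) "s \<le> lam ! i" "\<And>j. i < j \<Longrightarrow> j < length lam \<Longrightarrow> s \<noteq> lam ! i - lam ! j"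
      unfolding bar_lengths_def by auto
    then show False
    proof cases
      case add
      then show False
        using core i less_iff[of i j] nth_mem[of i lam] nth_mem[of j lam]
        unfolding bar_core_set_def by (metis less_irrefl)
    next
      case sub
      have "s \<noteq> lam ! i"
        using core i by (auto simp: bar_core_set_def)
      then have "lam ! i - s \<in> set lam"
        using core i sub(1) by (auto simp: bar_core_set_def)
      then obtain j where j: "j < length lam" "lam ! j = lam ! i - s"
        by (auto simp: in_set_conv_nth)
      then have "i < j"
        using less_iff[of i j] i s sub(1) by simp
      then show False
        using sub(2)[OF _ j(1)] sub(1) j(2) by simp
    qed
  qed
  then show "bar_core s lam"
    using lam by (simp add: bar_core_def)
qed

lemma bc_eq_card_bar_core_sets:
  assumes s: "s > 0"
  shows "bc s n = card {A. bar_core_set s A \<and> \<Sum>A = n}"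
proof -
  have "inj_on set (Collect strict_partition)"
  proof (rule inj_onI)
    fix l l' assume "l \<in> Collect strict_partition" "l' \<in> Collect strict_partition" "set l = set l'"
    then have "rev l = rev l'"
      by (intro strict_sorted_equal) (auto simp: strict_partition_def sorted_wrt_rev)
    then show "l = l'" by simp
  qed
  then have "inj_on set (bar_core_partitions s n)"
    by (rule inj_on_subset) (auto simp: bar_core_partitions_def bar_core_def)
  moreover have "set ` bar_core_partitions s n = {A. bar_core_set s A \<and> \<Sum>A = n}"
  proof (intro equalityI subsetI)
    fix A assume "A \<in> set ` bar_core_partitions s n"
    then obtain l where l: "A = set l" "bar_core s l" "sum_list l = n"
      by (auto simp: bar_core_partitions_def)
    then have "strict_partition l"
      by (simp add: bar_core_def)
    then show "A \<in> {A. bar_core_set s A \<and> \<Sum>A = n}"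
      using l bar_core_iff_bar_core_set[OF _ s] sum_list_distinct_conv_sum_set[of l "\<lambda>x. x"]
        strict_partition_distinct by simp
  next
    fix A assume A: "A \<in> {A. bar_core_set s A \<and> \<Sum>A = n}"
    define l where "l = rev (sorted_list_of_set A)"
    have fin: "finite A" and "0 \<notin> A"
      using A by (auto simp: bar_core_set_def)
    then have l: "strict_partition l" "set l = A"
      by (auto simp: l_def strict_partition_def sorted_wrt_rev intro!: gr0I)
    then have "sum_list l = \<Sum>A"
      using sum_list_distinct_conv_sum_set[of l "\<lambda>x. x"] strict_partition_distinct by simp
    then have "l \<in> bar_core_partitions s n"
      using A l bar_core_iff_bar_core_set[OF l(1) s] by (simp add: bar_core_partitions_def)
    then show "A \<in> set ` bar_core_partitions s n"
      using l(2) by blast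
  qed
  ultimately show ?thesis
    unfolding bc_def by (metis card_image)
qed

section \<open>Bar cores as independent choices of runs\<close>

definition bar_run :: "nat \<Rightarrow> nat \<Rightarrow> nat \<Rightarrow> nat set" where
  "bar_run s r k = (\<lambda>i. r + s * i) ` {..<k}"

text \<open>
  What a core may contain in the residues \<open>r\<close> and \<open>s - r\<close>: a run in one of the two, since nonempty
  runs in both would contain \<open>r\<close> and \<open>s - r\<close>, whose sum is \<open>s\<close>. For \<open>r = s - r\<close> the two families coincide.
\<close>

definition class_runs :: "nat \<Rightarrow> nat \<Rightarrow> nat set set" where
  "class_runs s r = range (bar_run s r) \<union> range (bar_run s (s - r))"

definition bar_class :: "nat \<Rightarrow> nat \<Rightarrow> nat set" where
  "bar_class s r = {a. a mod s = r \<or> a mod s = s - r}"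

lemma bar_run_0 [simp]: "bar_run s r 0 = {}"
  by (simp add: bar_run_def)

lemma finite_bar_run [simp]: "finite (bar_run s r k)"
  by (simp add: bar_run_def)

lemma card_bar_run: "s > 0 \<Longrightarrow> card (bar_run s r k) = k"
  unfolding bar_run_def by (subst card_image) (auto simp: inj_on_def)

lemma inj_bar_run: "s > 0 \<Longrightarrow> inj (bar_run s r)"
  by (metis card_bar_run injI)

text \<open>
  The size \<open>r k + s k(k-1)/2\<close> of a run is an exponent in a theta series, which is why
  the triple product identity enters.
\<close>

lemma sum_bar_run:
  assumes "s > 0"
  shows "\<Sum>(bar_run s r k) = r * k + s * (k choose 2)"
proof (induction k)
  case (Suc k)
  have "bar_run s r (Suc k) = insert (r + s * k) (bar_run s r k)"
    by (auto simp: bar_run_def lessThan_Suc)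
  moreover have "r + s * k \<notin> bar_run s r k"
    using assms by (auto simp: bar_run_def)
  ultimately show ?case
    using Suc.IH by (simp add: choose_two_Suc algebra_simps)
qed (simp add: binomial_eq_0)

lemma bar_run_mod:
  assumes "a \<in> bar_run s r k" "0 < r" "r < s"
  shows "a mod s = r"
  using assms by (auto simp: bar_run_def)

lemma bar_runs_disjoint:
  assumes "0 < r" "r < s" "0 < r'" "r' < s" "r \<noteq> r'"
  shows "bar_run s r k \<inter> bar_run s r' k' = {}"
  using assms bar_run_mod by blast

lemma class_runs_subset:
  assumes "X \<in> class_runs s r" "0 < r" "r < s"
  shows "finite X" "X \<subseteq> bar_class s r"
proof -
  show "finite X"
    using assms(1) by (auto simp: class_runs_def)
  have "0 < s - r" "s - r < s"
    using assms by auto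
  then show "X \<subseteq> bar_class s r"
    using assms bar_run_mod unfolding class_runs_def bar_class_def by blast
qed

lemma bar_class_disjoint:
  assumes "r \<in> {1..t}" "r' \<in> {1..t}" "r \<noteq> r'"
  shows "bar_class (2 * t) r \<inter> bar_class (2 * t) r' = {}"
  using assms by (auto simp: bar_class_def)

text \<open>
  Subtracting \<open>s\<close> from an element above \<open>s\<close> stays in the set, so the multipliers \<open>i\<close> with \<open>r + s i\<close> in the set form
  an initial segment of the naturals.
\<close>

lemma downward_closed_residue_is_bar_run:
  assumes fin: "finite A" and down: "\<And>a. a \<in> A \<Longrightarrow> s < a \<Longrightarrow> a - s \<in> A"
    and r: "0 < r" "r < s"
  obtains k where "{a \<in> A. a mod s = r} = bar_run s r k"
proof -
  define K where "K = {i. r + s * i \<in> A}"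
  have "finite K"
    unfolding K_def using fin r
    by (intro finite_vimageI[unfolded vimage_def]) (auto simp: inj_on_def)
  define k where "k = (LEAST k. k \<notin> K)"
  have "\<exists>k. k \<notin> K"
    using \<open>finite K\<close> ex_new_if_finite by blast
  then have k: "k \<notin> K" and below: "\<And>i. i < k \<Longrightarrow> i \<in> K"
    unfolding k_def using LeastI_ex[of "\<lambda>k. k \<notin> K"] not_less_Least[of _ "\<lambda>k. k \<notin> K"] by blast+
  have "i \<notin> K" if "k \<le> i" for i
    using that
  proof (induction i rule: dec_induct)
    case (step i)
    then show ?case
      using down[of "r + s * Suc i"] r by (auto simp: K_def)
  qed (rule k)
  then have K: "K = {..<k}"
    using below by (metis lessThan_iff linorder_not_less subsetI subset_antisym)
  have "{a \<in> A. a mod s = r} = (\<lambda>i. r + s * i) ` K"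
  proof (intro equalityI subsetI)
    fix a assume a: "a \<in> {a \<in> A. a mod s = r}"
    then have "a = r + s * (a div s)"
      by (metis (mono_tags, lifting) mem_Collect_eq mod_mult_div_eq)
    then show "a \<in> (\<lambda>i. r + s * i) ` K"
      using a by (metis (mono_tags, lifting) K_def image_eqI mem_Collect_eq)
  qed (use r in \<open>auto simp: K_def\<close>)
  then show thesis
    using that K by (simp add: bar_run_def)
qed

lemma bar_core_set_Int_class:
  assumes core: "bar_core_set s A" and s: "s = 2 * t" and r: "r \<in> {1..t}"
  shows "A \<inter> bar_class s r \<in> class_runs s r"
proof -
  have r': "0 < r" "r < s" "0 < s - r" "s - r < s"
    using r s by auto
  have fin: "finite A" and down: "\<And>a. a \<in> A \<Longrightarrow> s < a \<Longrightarrow> a - s \<in> A"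
    using core by (auto simp: bar_core_set_def)
  obtain k where k: "{a \<in> A. a mod s = r} = bar_run s r k"
    using downward_closed_residue_is_bar_run[OF fin down r'(1,2)] by blast
  obtain k' where k': "{a \<in> A. a mod s = s - r} = bar_run s (s - r) k'"
    using downward_closed_residue_is_bar_run[OF fin down r'(3,4)] by blast
  have split: "A \<inter> bar_class s r = bar_run s r k \<union> bar_run s (s - r) k'"
    unfolding k[symmetric] k'[symmetric] by (auto simp: bar_class_def)
  \<comment> \<open>If both runs were nonempty and different, their least elements would add up to \<open>s\<close>.\<close>
  consider "k = 0" | "k' = 0" | "r = s - r" | "k > 0" "k' > 0" "r \<noteq> s - r"
    by auto
  then show ?thesis
  proof cases
    case 3
    then have "bar_run s (s - r) k' = bar_run s r k"
      using k k' by simp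
    then show ?thesis by (simp add: split class_runs_def)
  next
    case 4
    have "r \<in> bar_run s r k" "s - r \<in> bar_run s (s - r) k'"
      using 4 by (auto simp: bar_run_def)
    then have "r \<in> A" "s - r \<in> A"
      using k k' by auto
    moreover have "r + (s - r) = s"
      using r' by simp
    ultimately have False
      using core 4(3) unfolding bar_core_set_def by blast
    then show ?thesis ..
  qed (auto simp: split class_runs_def)
qed

text \<open>
  Conversely, independent choices of runs always give a core: a forbidden sum \<open>a + b = s\<close> would
  involve the two complementary residues of one class, but the parts chosen from a class share one
  residue.
\<close>

lemma bar_core_set_UN_class_runs:
  assumes s: "s = 2 * t" and g: "g \<in> (\<Pi>\<^sub>E r\<in>{1..t}. class_runs s r)"
  shows "bar_core_set s (\<Union>r\<in>{1..t}. g r)"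
proof -
  have opt: "g r \<in> class_runs s r" if "r \<in> {1..t}" for r
    using g that by auto
  have run: "\<exists>r' k. g r = bar_run s r' k \<and> (r' = r \<or> r' = s - r) \<and> 0 < r' \<and> r' < s"
    if "r \<in> {1..t}" for r
    using opt[OF that] that s by (fastforce simp: class_runs_def)
  have cls: "g r \<subseteq> bar_class s r" if "r \<in> {1..t}" for r
    using class_runs_subset[OF opt[OF that]] that s by auto
  have mod_nz: "a mod s \<noteq> 0" if "r \<in> {1..t}" "a \<in> g r" for r a
    using cls[OF that(1)] that s by (auto simp: bar_class_def)
  have "finite (g r)" if "r \<in> {1..t}" for r
    using class_runs_subset[OF opt[OF that]] that s by auto
  moreover have "a - s \<in> g r" if a: "r \<in> {1..t}" "a \<in> g r" "s < a" for r a
  proof -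
    obtain r' k where r': "g r = bar_run s r' k" "r' < s"
      using run[OF a(1)] by blast
    then obtain i where i: "i < k" "a = r' + s * i"
      using a(2) r' by (auto simp: bar_run_def)
    then obtain j where "i = Suc j"
      using a(3) r'(2) by (cases i) auto
    then have "a - s = r' + s * j" "j < k"
      using i by auto
    then show ?thesis
      by (auto simp: r' bar_run_def)
  qed
  moreover have False
    if "r \<in> {1..t}" "a \<in> g r" "r' \<in> {1..t}" "b \<in> g r'" "a \<noteq> b" "a + b = s" for r a r' b
  proof -
    have nz: "a \<noteq> 0" "b \<noteq> 0"
      using mod_nz[OF that(1,2)] mod_nz[OF that(3,4)] by (auto intro!: gr0I)
    then have ab: "a < s" "b < s" "b = s - a"
      using that by auto
    then have "a \<in> bar_class s r'"
      using cls[OF that(3)] that(4) nz by (auto simp: bar_class_def)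
    then have "r = r'"
      using cls[OF that(1)] that(1-3) bar_class_disjoint[of r t r'] s by blast
    then have "a mod s = b mod s"
      using run[OF that(1)] that bar_run_mod by metis
    then show False
      using ab that by simp
  qed
  ultimately show ?thesis
    using mod_nz unfolding bar_core_set_def by (fastforce simp del: One_nat_def)
qed

lemma UN_class_runs_Int:
  assumes s: "s = 2 * t" and g: "g \<in> (\<Pi>\<^sub>E r\<in>{1..t}. class_runs s r)" and r: "r \<in> {1..t}"
  shows "(\<Union>r\<in>{1..t}. g r) \<inter> bar_class s r = g r"
proof -
  have "g r \<subseteq> bar_class s r" if r: "r \<in> {1..t}" for r
  proof (rule class_runs_subset(2))
    show "g r \<in> class_runs s r"
      using PiE_mem[OF g r] .
  qed (use r s in auto)
  then show ?thesis
    using bar_class_disjoint[of _ t r] r s by blast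
qed

text \<open>
  The classes of \<open>1\<close>, ..., \<open>t\<close> cover every residue modulo \<open>2 t\<close> except \<open>0\<close>, and a core has no part
  divisible by \<open>s\<close>: subtracting \<open>s\<close> repeatedly would lead to the part \<open>s\<close>.
\<close>

lemma bar_core_set_eq_UN_classes:
  assumes core: "bar_core_set s A" and s: "s = 2 * t" "t > 0"
  shows "(\<Union>r\<in>{1..t}. A \<inter> bar_class s r) = A"
proof -
  have "a mod s \<noteq> 0" if "a \<in> A" for a
  proof
    assume "a mod s = 0"
    then obtain m where m: "a = s * m" by auto
    have "s * m \<notin> A" for m
    proof (induction m)
      case (Suc m)
      then show ?case
        using core s by (cases m) (fastforce simp: bar_core_set_def)+
    qed (use core in \<open>simp add: bar_core_set_def\<close>)
    with m that show False by blast
  qed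
  then have "\<exists>r\<in>{1..t}. a \<in> bar_class s r" if "a \<in> A" for a
    using that s
    by (intro bexI[of _ "if a mod s \<le> t then a mod s else s - a mod s"])
      (auto simp: bar_class_def not_le Suc_le_eq)
  then show ?thesis by blast
qed

lemma bij_betw_bar_core_sets:
  assumes s: "s = 2 * t" "t > 0"
  shows "bij_betw (\<lambda>g. \<Union>r\<in>{1..t}. g r) (\<Pi>\<^sub>E r\<in>{1..t}. class_runs s r) {A. bar_core_set s A}"
proof (rule bij_betw_byWitness[where f' = "\<lambda>A. \<lambda>r\<in>{1..t}. A \<inter> bar_class s r"])
  show "\<forall>g\<in>\<Pi>\<^sub>E r\<in>{1..t}. class_runs s r.
      (\<lambda>r\<in>{1..t}. (\<Union>r\<in>{1..t}. g r) \<inter> bar_class s r) = g"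
  proof
    fix g assume g: "g \<in> (\<Pi>\<^sub>E r\<in>{1..t}. class_runs s r)"
    show "(\<lambda>r\<in>{1..t}. (\<Union>r\<in>{1..t}. g r) \<inter> bar_class s r) = g"
    proof
      fix r show "(\<lambda>r\<in>{1..t}. (\<Union>r\<in>{1..t}. g r) \<inter> bar_class s r) r = g r"
        using UN_class_runs_Int[OF s(1) g, of r] PiE_arb[OF g, of r]
        by (cases "r \<in> {1..t}") auto
    qed
  qed
  show "\<forall>A\<in>{A. bar_core_set s A}. (\<Union>r\<in>{1..t}. (\<lambda>r\<in>{1..t}. A \<inter> bar_class s r) r) = A"
    using bar_core_set_eq_UN_classes s by simp
  show "(\<lambda>g. \<Union>r\<in>{1..t}. g r) ` (\<Pi>\<^sub>E r\<in>{1..t}. class_runs s r) \<subseteq> {A. bar_core_set s A}"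
    using bar_core_set_UN_class_runs s by blast
  show "(\<lambda>A. \<lambda>r\<in>{1..t}. A \<inter> bar_class s r) ` {A. bar_core_set s A}
      \<subseteq> (\<Pi>\<^sub>E r\<in>{1..t}. class_runs s r)"
    using bar_core_set_Int_class s by auto
qed

section \<open>The generating function\<close>

lemma power_sum_bar_run:
  fixes q :: complex
  assumes "0 < r" "r < s"
  shows "q ^ \<Sum>(bar_run s r k) = (q ^ r) ^ k * (q ^ r * q ^ (s - r)) ^ (k choose 2)"
proof -
  have "q ^ r * q ^ (s - r) = q ^ s"
    using assms by (simp flip: power_add)
  then show ?thesis
    using assms by (simp add: sum_bar_run power_add power_mult)
qed

text \<open>
  The runs in residue \<open>r\<close> give the terms of nonnegative index of the theta series with
  \<open>a = q\<^sup>r\<close> and \<open>b = q^(s - r)\<close>, and the nonempty runs in residue \<open>s - r\<close> give those of negative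
  index; the empty run belongs to both families and is counted with the first.
\<close>

lemma has_sum_class_runs:
  assumes q: "norm q < 1" and r: "0 < r" "r < s" "r \<noteq> s - r"
  shows "((\<lambda>X. q ^ \<Sum>X) has_sum
    (qpoch_inf (q ^ s) (q ^ s) * (qpoch_inf (- (q ^ r)) (q ^ s) * qpoch_inf (- (q ^ (s - r))) (q ^ s))))
    (class_runs s r)"
proof -
  define a b where "a = q ^ r" and "b = q ^ (s - r)"
  have s: "s > 0" and r': "0 < s - r" "s - r < s"
    using r by auto
  have ab: "a * b = q ^ s"
    using r by (simp add: a_def b_def flip: power_add)
  have norms: "norm a < 1" "norm b < 1"
    using q r by (simp_all add: a_def b_def norm_power power_less_one_iff)
  define P where "P k = a ^ k * (a * b) ^ (k choose 2)" for k
  define M where "M k = (if k = 0 then 0 else b ^ k * (a * b) ^ (k choose 2))" for k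
  have sumP: "summable (\<lambda>k. norm (P k))"
    unfolding P_def by (rule summable_norm_theta[OF norms])
  have "summable (\<lambda>k. norm (b ^ k * (a * b) ^ (k choose 2)))"
    using summable_norm_theta[OF norms(2,1)] by (simp add: mult.commute)
  then have sumM: "summable (\<lambda>k. norm (M k))"
    by (rule summable_comparison_test'[where N = 0]) (simp add: M_def)
  have P: "(P has_sum suminf P) UNIV"
    by (rule norm_summable_imp_has_sum[OF sumP summable_sums[OF summable_norm_cancel[OF sumP]]])
  have "(M has_sum suminf M) UNIV"
    by (rule norm_summable_imp_has_sum[OF sumM summable_sums[OF summable_norm_cancel[OF sumM]]])
  moreover have "(M has_sum suminf M) UNIV \<longleftrightarrow>
      ((\<lambda>k. b ^ k * (a * b) ^ (k choose 2)) has_sum suminf M) {0<..}"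
    by (rule has_sum_cong_neutral) (auto simp: M_def)
  ultimately have M: "((\<lambda>k. b ^ k * (a * b) ^ (k choose 2)) has_sum suminf M) {0<..}"
    by simp
  have "((\<lambda>X. q ^ \<Sum>X) has_sum suminf P) (range (bar_run s r))"
    using P s r by (subst has_sum_reindex[OF inj_bar_run])
      (simp_all add: o_def power_sum_bar_run P_def[abs_def] a_def b_def)
  moreover have "((\<lambda>X. q ^ \<Sum>X) has_sum suminf M) (bar_run s (s - r) ` {0<..})"
  proof (subst has_sum_reindex)
    show "inj_on (bar_run s (s - r)) {0<..}"
      using inj_bar_run[OF s] by (rule inj_on_subset) simp
    show "(((\<lambda>X. q ^ \<Sum>X) \<circ> bar_run s (s - r)) has_sum suminf M) {0<..}"
      using M r by (simp add: o_def power_sum_bar_run[OF r'] a_def b_def mult.commute)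
  qed
  moreover have "range (bar_run s r) \<inter> bar_run s (s - r) ` {0<..} = {}"
  proof -
    have "bar_run s r k \<noteq> bar_run s (s - r) k'" if "k' > 0" for k k'
    proof
      assume "bar_run s r k = bar_run s (s - r) k'"
      then have "bar_run s (s - r) k' = {}"
        using bar_runs_disjoint[OF r(1,2) r' r(3), of k k'] by simp
      then show False
        using card_bar_run[OF s, of "s - r" k'] that by simp
    qed
    then show ?thesis by auto
  qed
  ultimately have "((\<lambda>X. q ^ \<Sum>X) has_sum (suminf P + suminf M))
      (range (bar_run s r) \<union> bar_run s (s - r) ` {0<..})"
    by (rule has_sum_Un_disjoint)
  also have "range (bar_run s r) \<union> bar_run s (s - r) ` {0<..} = class_runs s r"
  proof -
    have "bar_run s (s - r) k \<in> range (bar_run s r) \<union> bar_run s (s - r) ` {0<..}" for k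
    proof (cases k)
      case 0
      then have "bar_run s (s - r) k = bar_run s r 0" by simp
      then show ?thesis by blast
    qed auto
    then show ?thesis
      by (auto simp: class_runs_def)
  qed
  also have "suminf P + suminf M = suminf (two_sided_theta a b)"
    using suminf_add[OF summable_norm_cancel[OF sumP] summable_norm_cancel[OF sumM]]
    by (simp add: two_sided_theta_def[abs_def] P_def[abs_def] M_def[abs_def])
  also have "\<dots> = qpoch_inf (a * b) (a * b) * qpoch_inf (- a) (a * b) * qpoch_inf (- b) (a * b)"
    using jacobi_triple_product[OF norms] by (simp add: sums_iff)
  finally show ?thesis
    unfolding ab by (simp add: a_def b_def mult.assoc)
qed

text \<open>
  For the self-complementary residue \<open>t = s / 2\<close> there is only one family of runs, and so only the
  half of a theta series with nonnegative index.
\<close>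

lemma has_sum_class_runs_middle:
  fixes q :: complex
  assumes q: "norm q < 1" and s: "s = 2 * t" "t > 0"
  shows "((\<lambda>X. q ^ \<Sum>X) has_sum (\<Sum>n. q ^ (t * n\<^sup>2))) (class_runs s t)"
proof -
  have two: "2 * (k choose 2) + k = k\<^sup>2" for k
    by (induction k) (simp_all add: choose_two_Suc power2_eq_square binomial_eq_0)
  have size: "\<Sum>(bar_run s t k) = t * k\<^sup>2" for k
  proof -
    have "\<Sum>(bar_run s t k) = t * (2 * (k choose 2) + k)"
      using s by (simp add: sum_bar_run algebra_simps)
    then show ?thesis by (simp only: two)
  qed
  have "summable (\<lambda>n. norm (q ^ (t * n\<^sup>2)))"
  proof (rule summable_comparison_test')
    show "summable (\<lambda>n. norm q ^ n)"
      using q by (intro summable_geometric) simp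
    fix n :: nat
    have "n * 1 \<le> (t * n) * n" if "n > 0"
      using that s by (intro mult_le_mono) auto
    then have "n \<le> t * n\<^sup>2"
      by (cases "n = 0") (auto simp: power2_eq_square mult.assoc)
    then show "norm (norm (q ^ (t * n\<^sup>2))) \<le> norm q ^ n"
      using q by (simp add: norm_power power_decreasing)
  qed
  from norm_summable_imp_has_sum[OF this summable_sums[OF summable_norm_cancel[OF this]]]
  have "((\<lambda>n. q ^ (t * n\<^sup>2)) has_sum (\<Sum>n. q ^ (t * n\<^sup>2))) UNIV" .
  moreover have "class_runs s t = range (bar_run s t)"
    using s by (simp add: class_runs_def)
  moreover have "s > 0"
    using s by simp
  ultimately show ?thesis
    by (simp add: has_sum_reindex inj_bar_run o_def size)
qed

text \<open>
  The size of a core is the sum of the sizes of its runs, and the runs are chosen independently, so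
  the generating function factorises over the classes.
\<close>

lemma has_sum_bar_core_sets:
  fixes q :: complex
  assumes q: "norm q < 1" and s: "s = 2 * t" "t > 0"
  shows "((\<lambda>A. q ^ \<Sum>A) has_sum (\<Prod>r\<in>{1..t}. \<Sum>\<^sub>\<infinity>X\<in>class_runs s r. q ^ \<Sum>X))
    {A. bar_core_set s A}"
proof -
  let ?PiE = "\<Pi>\<^sub>E r\<in>{1..t}. class_runs s r"
  have summable: "(\<lambda>X. q ^ \<Sum>X) summable_on class_runs s r" if "r \<in> {1..t}" for r
  proof (cases "r = t")
    case True
    then show ?thesis
      using has_sum_class_runs_middle[OF q s] has_sum_imp_summable by blast
  next
    case False
    then have "0 < r" "r < s" "r \<noteq> s - r"
      using that s by auto
    from has_sum_class_runs[OF q this] show ?thesis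
      by (rule has_sum_imp_summable)
  qed
  have abs: "(\<lambda>X. norm (q ^ \<Sum>X)) summable_on class_runs s r" if "r \<in> {1..t}" for r
    by (rule summable_on_iff_abs_summable_on_complex[THEN iffD1]) (rule summable[OF that])
  have "Infinite_Set_Sum.abs_summable_on (\<lambda>g. \<Prod>r\<in>{1..t}. q ^ \<Sum>(g r)) ?PiE"
    using abs by (intro Infinite_Set_Sum.abs_summable_on_prod_PiE)
      (auto simp: abs_summable_equivalent class_runs_def)
  then have "(\<lambda>g. \<Prod>r\<in>{1..t}. q ^ \<Sum>(g r)) summable_on ?PiE"
    by (simp add: abs_summable_summable flip: abs_summable_equivalent)
  then have "((\<lambda>g. \<Prod>r\<in>{1..t}. q ^ \<Sum>(g r)) has_sum
      (\<Prod>r\<in>{1..t}. \<Sum>\<^sub>\<infinity>X\<in>class_runs s r. q ^ \<Sum>X)) ?PiE"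
    using infsum_prod_PiE_abs[of "{1..t}" "\<lambda>_ X. q ^ \<Sum>X" "class_runs s"] abs
    by (simp add: has_sum_iff)
  also have "?this \<longleftrightarrow> ((\<lambda>g. q ^ \<Sum>(\<Union>r\<in>{1..t}. g r)) has_sum
      (\<Prod>r\<in>{1..t}. \<Sum>\<^sub>\<infinity>X\<in>class_runs s r. q ^ \<Sum>X)) ?PiE"
  proof (rule has_sum_cong)
    fix g assume g: "g \<in> ?PiE"
    have opt: "finite (g r)" "g r \<subseteq> bar_class s r" if r: "r \<in> {1..t}" for r
      using class_runs_subset[OF PiE_mem[OF g r]] r s by auto
    have "\<forall>r\<in>{1..t}. \<forall>r'\<in>{1..t}. r \<noteq> r' \<longrightarrow> g r \<inter> g r' = {}"
      using opt(2) bar_class_disjoint[of _ t] s(1) by blast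
    then have "\<Sum>(\<Union>r\<in>{1..t}. g r) = (\<Sum>r\<in>{1..t}. \<Sum>(g r))"
      using opt(1) by (intro sum.UNION_disjoint) auto
    then show "(\<Prod>r\<in>{1..t}. q ^ \<Sum>(g r)) = q ^ \<Sum>(\<Union>r\<in>{1..t}. g r)"
      by (simp add: power_sum)
  qed
  also have "\<dots> \<longleftrightarrow> ((\<lambda>A. q ^ \<Sum>A) has_sum
      (\<Prod>r\<in>{1..t}. \<Sum>\<^sub>\<infinity>X\<in>class_runs s r. q ^ \<Sum>X)) {A. bar_core_set s A}"
    by (rule has_sum_reindex_bij_betw[OF bij_betw_bar_core_sets[OF s]])
  finally show ?thesis .
qed

lemma finite_bar_core_sets: "finite {A. bar_core_set s A \<and> \<Sum>A = n}"
proof (rule finite_subset)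
  show "{A. bar_core_set s A \<and> \<Sum>A = n} \<subseteq> Pow {..n}"
    by (auto simp: bar_core_set_def intro: member_le_sum[where f = "\<lambda>x. x"])
qed simp

text \<open>
  Collecting the cores of equal size turns the sum over cores into a power series.
\<close>

lemma bc_sums_prod_class_runs:
  fixes q :: complex
  assumes q: "norm q < 1" and s: "s = 2 * t" "t > 0"
  shows "(\<lambda>n. of_nat (bc s n) * q ^ n) sums (\<Prod>r\<in>{1..t}. \<Sum>\<^sub>\<infinity>X\<in>class_runs s r. q ^ \<Sum>X)"
proof -
  let ?S = "Sigma UNIV (\<lambda>n. {A. bar_core_set s A \<and> \<Sum>A = n})"
  let ?G = "\<Prod>r\<in>{1..t}. \<Sum>\<^sub>\<infinity>X\<in>class_runs s r. q ^ \<Sum>X"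
  have "bij_betw snd ?S {A. bar_core_set s A}"
    by (rule bij_betw_byWitness[where f' = "\<lambda>A. (\<Sum>A, A)"]) auto
  from has_sum_reindex_bij_betw[OF this, of "\<lambda>A. q ^ \<Sum>A"]
  have "((\<lambda>p. q ^ \<Sum>(snd p)) has_sum ?G) ?S"
    using has_sum_bar_core_sets[OF q s] by simp
  moreover have "((\<lambda>A. q ^ \<Sum>(snd (n, A))) has_sum (of_nat (bc s n) * q ^ n))
      {A. bar_core_set s A \<and> \<Sum>A = n}" for n
  proof -
    have "((\<lambda>A. q ^ \<Sum>A) has_sum (\<Sum>A\<in>{A. bar_core_set s A \<and> \<Sum>A = n}. q ^ \<Sum>A))
        {A. bar_core_set s A \<and> \<Sum>A = n}"
      by (rule has_sum_finite) (rule finite_bar_core_sets)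
    moreover have "(\<Sum>A\<in>{A. bar_core_set s A \<and> \<Sum>A = n}. q ^ \<Sum>A) = of_nat (bc s n) * q ^ n"
      using bc_eq_card_bar_core_sets[of s n] s by simp
    ultimately show ?thesis by (simp only: snd_conv)
  qed
  ultimately have "((\<lambda>n. of_nat (bc s n) * q ^ n) has_sum ?G) UNIV"
    by (rule has_sum_Sigma')
  then show ?thesis
    by (rule has_sum_imp_sums)
qed

text \<open>
  Sorting the factors \<open>1 + q\<^sup>i\<close> by \<open>i\<close> modulo \<open>s\<close>: the residues other than \<open>0\<close> and \<open>t\<close> come in pairs
  \<open>r\<close>, \<open>s - r\<close>, while the residues \<open>0\<close> and \<open>t\<close> together are the multiples of \<open>t\<close>.
\<close>

lemma qpoch_inf_pair_residues:
  assumes q: "norm q < 1" and s: "s = 2 * t" "t > 0"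
  shows "qpoch_inf (- q) q = qpoch_inf (- (q ^ t)) (q ^ t) *
    (\<Prod>r\<in>{1..<t}. qpoch_inf (- (q ^ r)) (q ^ s) * qpoch_inf (- (q ^ (s - r))) (q ^ s))"
proof -
  define F where "F r = qpoch_inf (- (q ^ r)) (q ^ s)" for r
  have "qpoch_inf (- q) q = (\<Prod>r<s. F (Suc r))"
    using qpoch_inf_dissect[OF q, of s "- q"] s by (simp add: F_def)
  also have "\<dots> = (\<Prod>r\<in>{1..s}. F r)"
    by (rule prod.reindex_bij_witness[of _ "\<lambda>r. r - 1" Suc]) auto
  also have "{1..s} = {1..<t} \<union> ((\<lambda>r. s - r) ` {1..<t}) \<union> {t, s}"
  proof (intro equalityI subsetI)
    fix i assume i: "i \<in> {1..s}"
    then have "i = s - (s - i)" by simp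
    then show "i \<in> {1..<t} \<union> ((\<lambda>r. s - r) ` {1..<t}) \<union> {t, s}"
      using i s by (cases "i \<le> t") (auto intro!: image_eqI[of _ _ "s - i"])
  qed (use s in auto)
  also have "(\<Prod>r\<in>\<dots>. F r) = (\<Prod>r\<in>{1..<t}. F r) * (\<Prod>r\<in>(\<lambda>r. s - r) ` {1..<t}. F r) * (F t * F s)"
    using s by (subst prod.union_disjoint, simp, simp, force)+ simp
  also have "(\<Prod>r\<in>(\<lambda>r. s - r) ` {1..<t}. F r) = (\<Prod>r\<in>{1..<t}. F (s - r))"
    using s by (subst prod.reindex) (auto simp: inj_on_def)
  also have "F t * F s = qpoch_inf (- (q ^ t)) (q ^ t)"
  proof -
    have "norm (q ^ t) < 1"
      using q s by (simp add: norm_power power_less_one_iff)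
    from qpoch_inf_dissect[OF this, of 2 "- (q ^ t)"] show ?thesis
      using s by (simp add: F_def numeral_2_eq_2 flip: power_mult power_add)
  qed
  finally show ?thesis
    by (simp add: F_def prod.distrib mult_ac)
qed

theorem proposition2p8:
  fixes s :: nat and q :: complex
  assumes "even s" and "s > 0" and "norm q < 1"
  shows "(\<lambda>n. of_nat (bc s n) * q ^ n) sums
    (qpoch_inf (- q) q * qpoch_inf (q ^ s) (q ^ s) ^ ((s - 2) div 2)
       / qpoch_inf (- (q ^ (s div 2))) (q ^ (s div 2))
     * (\<Sum>n. q ^ (s * n\<^sup>2 div 2)))"
proof -
  define t where "t = s div 2"
  have s: "s = 2 * t" "t > 0"
    using assms by (auto simp: t_def elim: evenE)
  note q = \<open>norm q < 1\<close>
  define D where "D = qpoch_inf (- (q ^ t)) (q ^ t)"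
  define E where "E = qpoch_inf (q ^ s) (q ^ s)"
  define R where "R r = qpoch_inf (- (q ^ r)) (q ^ s) * qpoch_inf (- (q ^ (s - r))) (q ^ s)" for r
  define T where "T = (\<Sum>n. q ^ (s * n\<^sup>2 div 2))"
  have "norm (q ^ t) < 1"
    using q s by (simp add: norm_power power_less_one_iff)
  then have D: "D \<noteq> 0"
    unfolding D_def by (intro qpoch_inf_nonzero) simp_all
  have pairs: "(\<Sum>\<^sub>\<infinity>X\<in>class_runs s r. q ^ \<Sum>X) = E * R r" if "r \<in> {1..<t}" for r
    unfolding E_def R_def using that s by (intro infsumI has_sum_class_runs q) auto
  have middle: "(\<Sum>\<^sub>\<infinity>X\<in>class_runs s t. q ^ \<Sum>X) = T"
    unfolding T_def using infsumI[OF has_sum_class_runs_middle[OF q s]] s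
    by (simp add: mult.assoc)
  have "{1..t} = insert t {1..<t}"
    using s by auto
  then have "(\<Prod>r\<in>{1..t}. \<Sum>\<^sub>\<infinity>X\<in>class_runs s r. q ^ \<Sum>X) = T * (\<Prod>r\<in>{1..<t}. E * R r)"
    by (simp add: middle pairs)
  also have "\<dots> = T * (E ^ (t - 1) * (\<Prod>r\<in>{1..<t}. R r))"
    by (simp add: prod.distrib)
  also have "(\<Prod>r\<in>{1..<t}. R r) = qpoch_inf (- q) q / D"
    using qpoch_inf_pair_residues[OF q s] D by (simp add: R_def D_def)
  also have "T * (E ^ (t - 1) * (qpoch_inf (- q) q / D)) = qpoch_inf (- q) q * E ^ (t - 1) / D * T"
    by simp
  finally have "(\<Prod>r\<in>{1..t}. \<Sum>\<^sub>\<infinity>X\<in>class_runs s r. q ^ \<Sum>X)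
      = qpoch_inf (- q) q * E ^ (t - 1) / D * T" .
  moreover have "(s - 2) div 2 = t - 1"
    using s by simp
  ultimately show ?thesis
    using bc_sums_prod_class_runs[OF q s] by (simp add: D_def E_def T_def flip: t_def)
qed

end
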